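(* Let $a_1\in\mathbb{R}\setminus\{0\}$ and $a_2,a_3\in\mathbb{C}\setminus\{0\}$ with $a_2a_3\in\mathbb{R}$, and let $X=X_{a_1,a_2,a_3}\subset\mathbb{P}^2_{\mathbb C}$ be the plane quartic $$y^4+y^2(x-a_1z)\Bigl(x+\tfrac{1}{a_1}z\Bigr)+(x-a_2z)\Bigl(x+\tfrac{1}{\overline{a_2}}z\Bigr)(x-a_3z)\Bigl(x+\tfrac{1}{\overline{a_3}}z\Bigr)=0.$$ Assume that $X$ is smooth and that $\operatorname{Aut}(X)\cong C_2$ (cyclic of order two). Then the field of moduli of $X$ relative to the extension $\mathbb{C}/\mathbb{R}$ is $\mathbb{R}$, and $\mathbb{R}$ is not a field of definition for $X$.
   Context: The field of moduli of a curve $X$ over $F$ relative to an extension $F/L$ is the fixed field of $\{\sigma\in\operatorname{Aut}(F/L): X\cong X^\sigma \text{ over } F\}$, where $X^\sigma$ is obtained by applying $\sigma$ to the coefficients of the equations of $X$. A subfield $N\subseteq F$ is a field of definition of $X$ if there is a curve defined over $N$ that is isomorphic to $X$ over $F$. *)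

theory Defs
  imports
    Complex_Main
    "HOL-Library.Poly_Mapping"
    "HOL-Library.FuncSet"
    "HOL-Computational_Algebra.Fundamental_Theorem_Algebra"
    "HOL-Algebra.Bij"
    "HOL-Algebra.Elementary_Groups"
begin

section \<open>Multivariate polynomials\<close>

text \<open>Polynomials in the variables $x_0, x_1, \ldots$: finitely supported maps from
  exponent vectors to coefficients.\<close>

type_synonym 'a mpoly = "(nat \<Rightarrow>\<^sub>0 nat) \<Rightarrow>\<^sub>0 'a"

definition mvar :: "nat \<Rightarrow> 'a::comm_ring_1 mpoly" where
  "mvar i = Poly_Mapping.single (Poly_Mapping.single i 1) 1"

definition mconst :: "'a::comm_ring_1 \<Rightarrow> 'a mpoly" where
  "mconst c = Poly_Mapping.single 0 c"

definition meval :: "'a::comm_ring_1 mpoly \<Rightarrow> (nat \<Rightarrow> 'a) \<Rightarrow> 'a" where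
  "meval p v = (\<Sum>e\<in>Poly_Mapping.keys p.
      Poly_Mapping.lookup p e *
        (\<Prod>i\<in>Poly_Mapping.keys e. v i ^ Poly_Mapping.lookup e i))"

definition mderiv :: "nat \<Rightarrow> 'a::comm_ring_1 mpoly \<Rightarrow> 'a mpoly" where
  "mderiv i p = (\<Sum>e\<in>Poly_Mapping.keys p.
      Poly_Mapping.single (e - Poly_Mapping.single i 1)
        (of_nat (Poly_Mapping.lookup e i) * Poly_Mapping.lookup p e))"

text \<open>The zero polynomial is a form of every degree.\<close>

definition is_form :: "nat \<Rightarrow> nat \<Rightarrow> 'a::comm_ring_1 mpoly \<Rightarrow> bool" where
  "is_form n d p \<longleftrightarrow> (\<forall>e\<in>Poly_Mapping.keys p.
      Poly_Mapping.keys e \<subseteq> {..n} \<and>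
      (\<Sum>i\<in>Poly_Mapping.keys e. Poly_Mapping.lookup e i) = d)"

definition forms :: "nat \<Rightarrow> 'a::comm_ring_1 mpoly set" where
  "forms n = {p. \<exists>d. is_form n d p}"


section \<open>Projective varieties\<close>

text \<open>Varieties are sets of closed points of $\mathbb{P}^n$ over an algebraically closed
  field, always given together with the ambient dimension \<open>n\<close>. A homogeneous coordinate
  vector $(v_0 : \ldots : v_n)$ is a function that vanishes beyond \<open>n\<close>, and a point is the
  set of all its coordinate vectors.\<close>

definition coords :: "nat \<Rightarrow> (nat \<Rightarrow> 'a::field) set" where
  "coords n = {v. (\<exists>i\<le>n. v i \<noteq> 0) \<and> (\<forall>i>n. v i = 0)}"

type_synonym 'a point = "(nat \<Rightarrow> 'a) set"

definition proj_point :: "(nat \<Rightarrow> 'a::field) \<Rightarrow> 'a point" where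
  "proj_point v = {(\<lambda>i. c * v i) | c. c \<noteq> 0}"

definition proj_space :: "nat \<Rightarrow> 'a::field point set" where
  "proj_space n = proj_point ` coords n"

definition zero_locus :: "nat \<Rightarrow> 'a::field mpoly set \<Rightarrow> 'a point set" where
  "zero_locus n S = {P \<in> proj_space n. \<forall>p\<in>S. \<forall>v\<in>P. meval p v = 0}"

definition zariski_closed :: "nat \<Rightarrow> 'a::alg_closed_field point set \<Rightarrow> bool" where
  "zariski_closed n Z \<longleftrightarrow> (\<exists>S\<subseteq>forms n. Z = zero_locus n S)"

definition irreducible_closed :: "nat \<Rightarrow> 'a::alg_closed_field point set \<Rightarrow> bool" where
  "irreducible_closed n Z \<longleftrightarrow> zariski_closed n Z \<and> Z \<noteq> {} \<and>
     (\<forall>A B. zariski_closed n A \<and> zariski_closed n B \<and> Z = A \<union> B \<longrightarrow> Z = A \<or> Z = B)"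

definition has_irreducible_chain :: "nat \<Rightarrow> 'a::alg_closed_field point set \<Rightarrow> nat \<Rightarrow> bool" where
  "has_irreducible_chain n Y k \<longleftrightarrow> (\<exists>Z :: nat \<Rightarrow> 'a point set.
     (\<forall>i\<le>k. irreducible_closed n (Z i) \<and> Z i \<subseteq> Y) \<and> (\<forall>i<k. Z i \<subset> Z (Suc i)))"

definition projective_curve :: "nat \<Rightarrow> 'a::alg_closed_field point set \<Rightarrow> bool" where
  "projective_curve n Y \<longleftrightarrow>
     irreducible_closed n Y \<and> has_irreducible_chain n Y 1 \<and> \<not> has_irreducible_chain n Y 2"

text \<open>The equations of \<open>Y\<close>, i.e. the homogeneous elements of its vanishing ideal.\<close>

definition equations :: "nat \<Rightarrow> 'a::alg_closed_field point set \<Rightarrow> 'a mpoly set" where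
  "equations n Y = {p \<in> forms n. \<forall>P\<in>Y. \<forall>v\<in>P. meval p v = 0}"

text \<open>\<open>Y\<close> is defined over the subfield \<open>N\<close> if its vanishing ideal is generated by forms
  with coefficients in \<open>N\<close>. (Ideals are spans over the polynomial ring; allowing further
  variables in the multipliers makes no difference, as one can set them to zero.)\<close>

definition defined_over :: "'a::alg_closed_field set \<Rightarrow> nat \<Rightarrow> 'a point set \<Rightarrow> bool" where
  "defined_over N n Y \<longleftrightarrow> (\<exists>S\<subseteq>equations n Y.
     (\<forall>p\<in>S. \<forall>e. Poly_Mapping.lookup p e \<in> N) \<and> equations n Y \<subseteq> module.span (*) S)"

definition smooth_hypersurface :: "nat \<Rightarrow> 'a::alg_closed_field mpoly \<Rightarrow> bool" where
  "smooth_hypersurface n F \<longleftrightarrow>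
     (\<forall>v\<in>coords n. meval F v = 0 \<longrightarrow> (\<exists>i\<le>n. meval (mderiv i F) v \<noteq> 0))"


section \<open>Morphisms\<close>

text \<open>A map is a morphism if every point \<open>P\<close> of \<open>X\<close> has a Zariski neighbourhood \<open>X - Z\<close> on
  which the map is given by forms of equal degree without common zeros there. Membership
  in \<open>coords m\<close> also forces the superfluous forms \<open>g j\<close>, \<open>j > m\<close>, to vanish on \<open>X - Z\<close>.\<close>

definition morphism ::
  "nat \<Rightarrow> 'a::alg_closed_field point set \<Rightarrow> nat \<Rightarrow> 'a point set \<Rightarrow> ('a point \<Rightarrow> 'a point) \<Rightarrow> bool" where
  "morphism n X m Y f \<longleftrightarrow> f \<in> X \<rightarrow> Y \<and>
     (\<forall>P\<in>X. \<exists>Z d g. zariski_closed n Z \<and> P \<notin> Z \<and> (\<forall>j. is_form n d (g j)) \<and>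
        (\<forall>Q\<in>X - Z. \<forall>v\<in>Q. (\<lambda>j. meval (g j) v) \<in> coords m \<and>
           f Q = proj_point (\<lambda>j. meval (g j) v)))"

definition isomorphism ::
  "nat \<Rightarrow> 'a::alg_closed_field point set \<Rightarrow> nat \<Rightarrow> 'a point set \<Rightarrow> ('a point \<Rightarrow> 'a point) \<Rightarrow> bool" where
  "isomorphism n X m Y f \<longleftrightarrow> morphism n X m Y f \<and>
     (\<exists>g. morphism m Y n X g \<and> (\<forall>P\<in>X. g (f P) = P) \<and> (\<forall>Q\<in>Y. f (g Q) = Q))"

definition isomorphic ::
  "nat \<Rightarrow> 'a::alg_closed_field point set \<Rightarrow> nat \<Rightarrow> 'a point set \<Rightarrow> bool" where
  "isomorphic n X m Y \<longleftrightarrow> (\<exists>f. isomorphism n X m Y f)"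

definition Aut :: "nat \<Rightarrow> 'a::alg_closed_field point set \<Rightarrow> ('a point \<Rightarrow> 'a point) monoid" where
  "Aut n X = (BijGroup X)\<lparr>carrier := {f \<in> Bij X. isomorphism n X n X f}\<rparr>"


section \<open>Fields of moduli and fields of definition\<close>

definition field_auts :: "'a::field set \<Rightarrow> ('a \<Rightarrow> 'a) set" where
  "field_auts L = {\<sigma>. bij \<sigma> \<and> (\<forall>x y. \<sigma> (x + y) = \<sigma> x + \<sigma> y) \<and>
     (\<forall>x y. \<sigma> (x * y) = \<sigma> x * \<sigma> y) \<and> (\<forall>c\<in>L. \<sigma> c = c)}"

definition conjugate_variety ::
  "nat \<Rightarrow> ('a::alg_closed_field \<Rightarrow> 'a) \<Rightarrow> 'a point set \<Rightarrow> 'a point set" where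
  "conjugate_variety n \<sigma> X = zero_locus n (Poly_Mapping.map \<sigma> ` equations n X)"

text \<open>In the next two definitions the big field \<open>F\<close> is the whole type, and \<open>L\<close> and \<open>N\<close>
  are meant to be subfields of it.\<close>

definition field_of_moduli :: "'a::alg_closed_field set \<Rightarrow> nat \<Rightarrow> 'a point set \<Rightarrow> 'a set" where
  "field_of_moduli L n X =
     {c. \<forall>\<sigma>\<in>field_auts L. isomorphic n X n (conjugate_variety n \<sigma> X) \<longrightarrow> \<sigma> c = c}"

definition field_of_definition :: "'a::alg_closed_field set \<Rightarrow> nat \<Rightarrow> 'a point set \<Rightarrow> bool" where
  "field_of_definition N n X \<longleftrightarrow>
     (\<exists>m Y. projective_curve m Y \<and> defined_over N m Y \<and> isomorphic n X m Y)"


section \<open>The quartics\<close>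

text \<open>The homogeneous coordinates $x, y, z$ are the variables 0, 1, 2.\<close>

definition quartic :: "complex \<Rightarrow> complex \<Rightarrow> complex \<Rightarrow> complex mpoly" where
  "quartic a1 a2 a3 = (let x = mvar 0; y = mvar 1; z = mvar 2 in
     y ^ 4 + y ^ 2 * (x - mconst a1 * z) * (x + mconst (1 / a1) * z)
     + (x - mconst a2 * z) * (x + mconst (1 / cnj a2) * z)
       * (x - mconst a3 * z) * (x + mconst (1 / cnj a3) * z))"

definition quartic_curve :: "complex \<Rightarrow> complex \<Rightarrow> complex \<Rightarrow> complex point set" where
  "quartic_curve a1 a2 a3 = zero_locus 2 {quartic a1 a2 a3}"

end

theory Submission
  imports Defs
begin

text \<open>
  Write \<open>X\<^sup>c\<close>, \<open>f\<^sup>c\<close> for complex conjugates. The map \<open>\<mu> (x : y : z) = (-z : iy : x)\<close>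
  is an isomorphism from \<open>X\<close> to \<open>X\<^sup>c\<close>, which settles the field of moduli. If \<open>f\<close> were
  an isomorphism from \<open>X\<close> to a curve \<open>Y\<close> over the reals, then \<open>Y\<^sup>c = Y\<close>, and
  \<open>\<phi> = (f\<^sup>c)\<^sup>-\<^sup>1 \<circ> f\<close> would be an isomorphism from \<open>X\<close> to \<open>X\<^sup>c\<close> with
  \<open>\<phi>\<^sup>c \<circ> \<phi> = id\<close>. The only automorphisms of \<open>X\<close> are the identity and
  \<open>\<iota> (x : y : z) = (x : -y : z)\<close>, so \<open>\<phi>\<close> is \<open>\<mu>\<close> or \<open>\<mu> \<circ> \<iota>\<close>; in both
  cases \<open>\<phi>\<^sup>c \<circ> \<phi> = \<iota>\<close>, which is not the identity on \<open>X\<close>.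
\<close>

section \<open>Evaluation and substitution of polynomials\<close>

definition meval_monom :: "(nat \<Rightarrow> 'a::comm_ring_1) \<Rightarrow> (nat \<Rightarrow>\<^sub>0 nat) \<Rightarrow> 'a" where
  "meval_monom v e = (\<Prod>i\<in>Poly_Mapping.keys e. v i ^ Poly_Mapping.lookup e i)"

lemma meval_alt:
  "meval p v = (\<Sum>e\<in>Poly_Mapping.keys p. Poly_Mapping.lookup p e * meval_monom v e)"
  by (simp add: meval_def meval_monom_def)

text \<open>The added indices carry exponent 0. Monomials with different supports can thus be
  compared over one index set.\<close>

lemma meval_monom_superset:
  assumes "finite A" "Poly_Mapping.keys e \<subseteq> A"
  shows "meval_monom v e = (\<Prod>i\<in>A. v i ^ Poly_Mapping.lookup e i)"
  unfolding meval_monom_def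
  by (rule prod.mono_neutral_left) (use assms in \<open>auto simp: in_keys_iff\<close>)

lemma meval_monom_add: "meval_monom v (e + e') = meval_monom v e * meval_monom v e'"
proof -
  let ?A = "Poly_Mapping.keys e \<union> Poly_Mapping.keys e'"
  have "meval_monom v (e + e') = (\<Prod>i\<in>?A. v i ^ Poly_Mapping.lookup (e + e') i)"
    by (rule meval_monom_superset) (use Poly_Mapping.keys_add[of e e'] in auto)
  also have "\<dots> = (\<Prod>i\<in>?A. v i ^ Poly_Mapping.lookup e i) * (\<Prod>i\<in>?A. v i ^ Poly_Mapping.lookup e' i)"
    by (simp add: lookup_add power_add prod.distrib)
  also have "\<dots> = meval_monom v e * meval_monom v e'"
    by (simp add: meval_monom_superset[of ?A])
  finally show ?thesis .
qed

lemma meval_0 [simp]: "meval 0 v = 0"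
  by (simp add: meval_def)

lemma meval_single [simp]: "meval (Poly_Mapping.single e c) v = c * meval_monom v e"
  by (simp add: meval_alt)

lemma meval_add [simp]: "meval (p + q) v = meval p v + meval q v"
  unfolding meval_alt by (rule setsum_keys_plus_distrib) (auto simp: algebra_simps)

lemma meval_sum [simp]: "meval (\<Sum>i\<in>I. p i) v = (\<Sum>i\<in>I. meval (p i) v)"
  by (induction I rule: infinite_finite_induct) auto

text \<open>Splitting polynomials into monomials reduces the multiplicativity of evaluation to
  \<open>meval_monom_add\<close>.\<close>

lemma sum_single_keys:
  "(\<Sum>e\<in>Poly_Mapping.keys p. Poly_Mapping.single e (Poly_Mapping.lookup p e)) = p"
  by (rule poly_mapping_eqI) (auto simp: lookup_sum lookup_single when_def in_keys_iff)

lemma meval_mult [simp]: "meval (p * q) v = meval p v * meval q v"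
proof -
  have "meval (p * q) v = meval
    ((\<Sum>e\<in>Poly_Mapping.keys p. Poly_Mapping.single e (Poly_Mapping.lookup p e)) *
     (\<Sum>e\<in>Poly_Mapping.keys q. Poly_Mapping.single e (Poly_Mapping.lookup q e))) v"
    by (simp only: sum_single_keys)
  also have "\<dots> = meval p v * meval q v"
    unfolding meval_alt[of p] meval_alt[of q] sum_product
    by (simp add: mult_single meval_monom_add mult_ac)
  finally show ?thesis .
qed

lemma meval_mconst [simp]: "meval (mconst c) v = c"
  by (simp add: mconst_def meval_monom_def)

lemma meval_mvar [simp]: "meval (mvar i) v = v i"
  by (simp add: mvar_def meval_monom_def)

lemma mconst_1: "mconst 1 = 1"
  by (simp add: mconst_def)

lemma meval_1 [simp]: "meval 1 v = 1"
  by (simp flip: mconst_1)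

lemma meval_uminus [simp]: "meval (- p) v = - meval p v"
  using meval_add[of p "- p" v] by (simp add: eq_neg_iff_add_eq_0 add.commute)

lemma meval_diff [simp]: "meval (p - q) v = meval p v - meval q v"
  using meval_add[of p "- q" v] by simp

lemma meval_power [simp]: "meval (p ^ k) v = meval p v ^ k"
  by (induction k) auto

lemma meval_prod [simp]: "meval (\<Prod>i\<in>I. p i) v = (\<Prod>i\<in>I. meval (p i) v)"
  by (induction I rule: infinite_finite_induct) auto

text \<open>This is the composition \<open>p(G 0, G 1, ...)\<close>. It supplies the forms of a
  composite of morphisms and the pullback of an equation.\<close>

definition msubst :: "(nat \<Rightarrow> 'a::comm_ring_1 mpoly) \<Rightarrow> 'a mpoly \<Rightarrow> 'a mpoly" where
  "msubst G p = (\<Sum>e\<in>Poly_Mapping.keys p. mconst (Poly_Mapping.lookup p e) *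
     (\<Prod>i\<in>Poly_Mapping.keys e. G i ^ Poly_Mapping.lookup e i))"

lemma meval_msubst [simp]: "meval (msubst G p) v = meval p (\<lambda>i. meval (G i) v)"
  by (simp add: msubst_def meval_def[of p])


section \<open>Forms\<close>

lemma is_form_0 [simp]: "is_form n d 0"
  by (simp add: is_form_def)

lemma is_form_mconst [simp]: "is_form n 0 (mconst c)"
  by (simp add: is_form_def mconst_def)

lemma is_form_1 [simp]: "is_form n 0 1"
  by (simp flip: mconst_1)

lemma is_form_mvar: "i \<le> n \<Longrightarrow> is_form n 1 (mvar i)"
  by (simp add: is_form_def mvar_def)

lemma is_form_add: "is_form n d p \<Longrightarrow> is_form n d q \<Longrightarrow> is_form n d (p + q)"
  unfolding is_form_def using Poly_Mapping.keys_add[of p q] by blast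

lemma is_form_sum: "(\<And>i. i \<in> I \<Longrightarrow> is_form n d (p i)) \<Longrightarrow> is_form n d (\<Sum>i\<in>I. p i)"
  by (induction I rule: infinite_finite_induct) (auto simp: is_form_add)

lemma is_form_mult:
  assumes "is_form n d p" "is_form n d' q"
  shows "is_form n (d + d') (p * q)"
  unfolding is_form_def
proof
  fix e assume "e \<in> Poly_Mapping.keys (p * q)"
  then obtain a b where e: "e = a + b" "a \<in> Poly_Mapping.keys p" "b \<in> Poly_Mapping.keys q"
    using keys_mult[of p q] by blast
  have "(\<Sum>i\<in>Poly_Mapping.keys (a + b). Poly_Mapping.lookup (a + b) i) =
    (\<Sum>i\<in>Poly_Mapping.keys a. Poly_Mapping.lookup a i) +
    (\<Sum>i\<in>Poly_Mapping.keys b. Poly_Mapping.lookup b i)"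
    by (rule setsum_keys_plus_distrib) auto
  then show "Poly_Mapping.keys e \<subseteq> {..n} \<and>
      (\<Sum>i\<in>Poly_Mapping.keys e. Poly_Mapping.lookup e i) = d + d'"
    using assms e Poly_Mapping.keys_add[of a b] unfolding is_form_def by fastforce
qed

lemma is_form_power: "is_form n d p \<Longrightarrow> is_form n (d * k) (p ^ k)"
  by (induction k) (auto simp: is_form_mult)

lemma is_form_prod:
  "(\<And>i. i \<in> I \<Longrightarrow> is_form n (d i) (p i)) \<Longrightarrow> is_form n (\<Sum>i\<in>I. d i) (\<Prod>i\<in>I. p i)"
  by (induction I rule: infinite_finite_induct) (auto simp: is_form_mult)

text \<open>Each monomial of \<open>p\<close> turns into a scalar times a product of
  \<open>d'\<close> factors among the \<open>G j\<close>, all of the same degree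
  \<open>d\<close>.\<close>

lemma is_form_msubst:
  assumes p: "is_form m d' p" and G: "\<And>j. is_form n d (G j)"
  shows "is_form n (d * d') (msubst G p)"
  unfolding msubst_def
proof (rule is_form_sum)
  fix e assume e: "e \<in> Poly_Mapping.keys p"
  have "is_form n (\<Sum>i\<in>Poly_Mapping.keys e. d * Poly_Mapping.lookup e i)
      (\<Prod>i\<in>Poly_Mapping.keys e. G i ^ Poly_Mapping.lookup e i)"
    by (intro is_form_prod is_form_power G)
  moreover have "(\<Sum>i\<in>Poly_Mapping.keys e. d * Poly_Mapping.lookup e i) = d * d'"
    using p e by (simp add: is_form_def flip: sum_distrib_left)
  ultimately show "is_form n (d * d') (mconst (Poly_Mapping.lookup p e) *
      (\<Prod>i\<in>Poly_Mapping.keys e. G i ^ Poly_Mapping.lookup e i))"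
    using is_form_mult[OF is_form_mconst] by fastforce
qed

text \<open>Every monomial of a form picks up the same factor. Hence the vanishing of a form at a
  point can be tested on any one coordinate vector.\<close>

lemma meval_scale:
  assumes "is_form n d p"
  shows "meval p (\<lambda>i. c * v i) = c ^ d * meval p v"
proof -
  have "meval_monom (\<lambda>i. c * v i) e = c ^ d * meval_monom v e" if "e \<in> Poly_Mapping.keys p" for e
    using assms that
    by (simp add: is_form_def meval_monom_def power_mult_distrib prod.distrib flip: power_sum)
  then show ?thesis
    by (simp add: meval_alt sum_distrib_left mult_ac)
qed


section \<open>Points, closed sets and morphisms\<close>

lemma self_in_proj_point: "v \<in> proj_point v"
  by (auto simp: proj_point_def intro!: exI[of _ 1])

lemma proj_spaceE:
  assumes "P \<in> proj_space n"
  obtains v where "v \<in> coords n" "P = proj_point v"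
  using assms by (auto simp: proj_space_def)

lemma scale_coords: "c \<noteq> 0 \<Longrightarrow> v \<in> coords n \<Longrightarrow> (\<lambda>i. c * v i) \<in> coords n"
  by (auto simp: coords_def)

lemma proj_space_member_coords: "P \<in> proj_space n \<Longrightarrow> v \<in> P \<Longrightarrow> v \<in> coords n"
  by (auto simp: proj_space_def proj_point_def intro: scale_coords)

text \<open>Scaling by \<open>c\<close> maps the point into itself, and so does scaling by
  \<open>inverse c\<close>, which gives the reverse inclusion.\<close>

lemma scale_image_point:
  fixes P :: "'a::field point"
  assumes "P \<in> proj_space n" "c \<noteq> 0"
  shows "(\<lambda>v i. c * v i) ` P = P"
proof -
  have sub: "(\<lambda>v i. b * v i) ` P \<subseteq> P" if b: "b \<noteq> 0" for b
  proof
    fix w assume "w \<in> (\<lambda>v i. b * v i) ` P"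
    moreover obtain u where P: "P = proj_point u"
      using assms by (elim proj_spaceE)
    ultimately obtain a where "a \<noteq> 0" "w = (\<lambda>i. b * (a * u i))"
      by (auto simp: proj_point_def)
    then have "b * a \<noteq> 0" "w = (\<lambda>i. (b * a) * u i)"
      using b by (auto simp: mult.assoc)
    then show "w \<in> P"
      unfolding P proj_point_def by blast
  qed
  have "P = (\<lambda>v i. c * v i) ` ((\<lambda>v i. inverse c * v i) ` P)"
    using assms by (simp add: image_image flip: mult.assoc)
  also have "\<dots> \<subseteq> (\<lambda>v i. c * v i) ` P"
    using assms by (intro image_mono sub) simp
  finally show ?thesis
    using sub[OF assms(2)] by blast
qed

lemma proj_point_eqI:
  assumes "P \<in> proj_space n" "v \<in> P"
  shows "P = proj_point v"
proof -
  obtain w where w: "P = proj_point w"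
    using assms by (elim proj_spaceE)
  obtain c where c: "c \<noteq> 0" "v = (\<lambda>i. c * w i)"
    using assms w by (auto simp: proj_point_def)
  have "proj_point v = (\<lambda>v i. c * v i) ` proj_point w"
    unfolding proj_point_def setcompr_eq_image image_image c(2) by (simp add: mult.left_commute)
  then show ?thesis
    using scale_image_point[OF assms(1) c(1)] w by simp
qed

lemma linear_image_proj_point:
  assumes "\<And>c. c \<noteq> 0 \<Longrightarrow> L (\<lambda>i. c * v i) = (\<lambda>i. c * L v i)"
  shows "L ` proj_point v = proj_point (L v)"
  unfolding proj_point_def setcompr_eq_image image_image by (rule image_cong) (auto simp: assms)

section \<open>Zero loci and Zariski closed sets\<close>

lemma zero_locus_subset: "zero_locus n S \<subseteq> proj_space n"
  by (auto simp: zero_locus_def)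

lemma zariski_closed_subset: "zariski_closed n Z \<Longrightarrow> Z \<subseteq> proj_space n"
  unfolding zariski_closed_def using zero_locus_subset by blast

text \<open>The constant \<open>1\<close> is a form of degree 0 without zeros. This allows
  \<open>Z = {}\<close> for maps that are given by the same forms everywhere.\<close>

lemma zariski_closed_empty: "zariski_closed n {}"
proof -
  have "zero_locus n {1} = ({} :: 'a point set)"
    using self_in_proj_point by (fastforce simp: zero_locus_def proj_space_def)
  then show ?thesis
    unfolding zariski_closed_def forms_def by (intro exI[of _ "{1}"]) (auto intro: exI[of _ 0])
qed

text \<open>The forms that cut out \<open>X\<close> are among its equations, so passing to the
  vanishing ideal and back recovers a closed set.\<close>

lemma zero_locus_equations:
  assumes "zariski_closed n X"
  shows "zero_locus n (equations n X) = X"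
proof
  obtain S where S: "S \<subseteq> forms n" "X = zero_locus n S"
    using assms by (auto simp: zariski_closed_def)
  then have "S \<subseteq> equations n X"
    by (auto simp: equations_def zero_locus_def)
  then show "zero_locus n (equations n X) \<subseteq> X"
    unfolding S(2) by (auto simp: zero_locus_def)
  show "X \<subseteq> zero_locus n (equations n X)"
    using S(2) by (auto simp: equations_def zero_locus_def)
qed

lemma zero_locus_singleton_iff:
  assumes "is_form n d s" "P \<in> proj_space n" "v \<in> P"
  shows "P \<in> zero_locus n {s} \<longleftrightarrow> meval s v = 0"
proof -
  obtain w where w: "P = proj_point w"
    using assms by (elim proj_spaceE)
  obtain c where c: "c \<noteq> 0" "v = (\<lambda>i. c * w i)"
    using assms w by (auto simp: proj_point_def)
  have "meval s (\<lambda>i. b * w i) = 0 \<longleftrightarrow> meval s w = 0" if "b \<noteq> 0" for b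
    using that by (simp add: meval_scale[OF assms(1)])
  then show ?thesis
    using assms(2) c unfolding zero_locus_def w by (auto simp: proj_point_def)
qed

text \<open>One of the forms defining \<open>Z\<close> does not vanish at \<open>P\<close>: the
  non-vanishing loci of single forms are a basis of the Zariski topology.\<close>

lemma zariski_closed_separate:
  assumes "zariski_closed n Z" "P \<in> proj_space n" "P \<notin> Z"
  obtains s d where "is_form n d s" "P \<notin> zero_locus n {s}" "Z \<subseteq> zero_locus n {s}"
proof -
  obtain S where "S \<subseteq> forms n" "Z = zero_locus n S"
    using assms by (auto simp: zariski_closed_def)
  with assms obtain s where s: "s \<in> S" "P \<notin> zero_locus n {s}"
    by (auto simp: zero_locus_def)
  moreover obtain d where "is_form n d s"
    using s \<open>S \<subseteq> forms n\<close> by (auto simp: forms_def)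
  ultimately show ?thesis
    using that \<open>Z = _\<close> by (auto simp: zero_locus_def)
qed

section \<open>Morphisms: local description, composition, linear maps\<close>

lemma morphism_Pi: "morphism n X m Y f \<Longrightarrow> P \<in> X \<Longrightarrow> f P \<in> Y"
  by (auto simp: morphism_def)

text \<open>The neighbourhood is shrunk to the non-vanishing locus of a single form
  \<open>s\<close>, which can be pulled back and multiplied with other forms.\<close>

lemma morphismE:
  assumes "morphism n X m Y f" "X \<subseteq> proj_space n" "P \<in> X"
  obtains s e d g where "is_form n e s" "P \<notin> zero_locus n {s}" "\<And>j. is_form n d (g j)"
    "\<And>Q v. Q \<in> X \<Longrightarrow> Q \<notin> zero_locus n {s} \<Longrightarrow> v \<in> Q \<Longrightarrow>
       (\<lambda>j. meval (g j) v) \<in> coords m \<and> f Q = proj_point (\<lambda>j. meval (g j) v)"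
proof -
  obtain Z d g where *: "zariski_closed n Z" "P \<notin> Z" "\<forall>j. is_form n d (g j)"
    "\<forall>Q\<in>X - Z. \<forall>v\<in>Q. (\<lambda>j. meval (g j) v) \<in> coords m \<and> f Q = proj_point (\<lambda>j. meval (g j) v)"
    using assms unfolding morphism_def by meson
  obtain s e where "is_form n e s" "P \<notin> zero_locus n {s}" "Z \<subseteq> zero_locus n {s}"
    by (rule zariski_closed_separate[OF *(1) subsetD[OF assms(2,3)] *(2)])
  moreover have "(\<lambda>j. meval (g j) v) \<in> coords m \<and> f Q = proj_point (\<lambda>j. meval (g j) v)"
    if "Q \<in> X" "Q \<notin> zero_locus n {s}" "v \<in> Q" for Q v
    using *(4) that \<open>Z \<subseteq> _\<close> by blast
  ultimately show ?thesis
    using *(3) by (intro that[of e s d g]) simp_all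
qed

lemma morphism_cong:
  assumes "morphism n X m Y f" "\<And>P. P \<in> X \<Longrightarrow> f P = f' P"
  shows "morphism n X m Y f'"
  using assms unfolding morphism_def by (simp add: Pi_iff)

text \<open>Near \<open>P\<close> the composite is given by the forms of \<open>g\<close> with those
  of \<open>f\<close> substituted. The work lies in finding a neighbourhood on which both local
  descriptions hold.\<close>

lemma morphism_compose:
  assumes f: "morphism n X m Y f" and g: "morphism m Y k W g"
    and X: "X \<subseteq> proj_space n" and Y: "Y \<subseteq> proj_space m"
  shows "morphism n X k W (g \<circ> f)"
  unfolding morphism_def
proof (intro conjI ballI)
  show "g \<circ> f \<in> X \<rightarrow> W"
    using f g by (auto simp: morphism_def)
  fix P assume P: "P \<in> X"
  obtain s e d F where s: "is_form n e s" "P \<notin> zero_locus n {s}" and F: "\<And>j. is_form n d (F j)"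
    and fF: "\<And>Q v. Q \<in> X \<Longrightarrow> Q \<notin> zero_locus n {s} \<Longrightarrow> v \<in> Q \<Longrightarrow>
       (\<lambda>j. meval (F j) v) \<in> coords m \<and> f Q = proj_point (\<lambda>j. meval (F j) v)"
    using morphismE[OF f X P] by metis
  have fP: "f P \<in> Y"
    using f P by (rule morphism_Pi)
  obtain t e' d' G where t: "is_form m e' t" "f P \<notin> zero_locus m {t}" and G: "\<And>j. is_form m d' (G j)"
    and gG: "\<And>Q v. Q \<in> Y \<Longrightarrow> Q \<notin> zero_locus m {t} \<Longrightarrow> v \<in> Q \<Longrightarrow>
       (\<lambda>j. meval (G j) v) \<in> coords k \<and> g Q = proj_point (\<lambda>j. meval (G j) v)"
    using morphismE[OF g Y fP] by metis
  \<comment> \<open>Where \<open>s\<close> is nonzero, \<open>F\<close> describes \<open>f\<close>;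
    there \<open>msubst F t\<close> is the pullback of \<open>t\<close>, and it is nonzero where
    \<open>G\<close> describes \<open>g\<close> at the image.\<close>
  let ?r = "s * msubst F t"
  have r: "is_form n (e + d * e') ?r"
    by (intro is_form_mult s is_form_msubst[OF t(1)] F)
  have *: "Q \<notin> zero_locus n {?r} \<longleftrightarrow> Q \<notin> zero_locus n {s} \<and> f Q \<notin> zero_locus m {t}"
    if Q: "Q \<in> X" for Q
  proof -
    have Qp: "Q \<in> proj_space n" and fQ: "f Q \<in> proj_space m"
      using Q X Y morphism_Pi[OF f Q] by auto
    obtain v where v: "v \<in> Q"
      using Qp self_in_proj_point by (elim proj_spaceE) blast
    show ?thesis
    proof (cases "Q \<in> zero_locus n {s}")
      case True
      then show ?thesis
        by (simp add: zero_locus_singleton_iff[OF r Qp v] zero_locus_singleton_iff[OF s(1) Qp v])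
    next
      case False
      have "(\<lambda>j. meval (F j) v) \<in> f Q"
        using fF[OF Q False v] self_in_proj_point by auto
      then have "f Q \<in> zero_locus m {t} \<longleftrightarrow> meval t (\<lambda>j. meval (F j) v) = 0"
        by (rule zero_locus_singleton_iff[OF t(1) fQ])
      then show ?thesis
        by (simp add: zero_locus_singleton_iff[OF r Qp v] zero_locus_singleton_iff[OF s(1) Qp v])
    qed
  qed
  show "\<exists>Z d h. zariski_closed n Z \<and> P \<notin> Z \<and> (\<forall>j. is_form n d (h j)) \<and>
        (\<forall>Q\<in>X - Z. \<forall>v\<in>Q. (\<lambda>j. meval (h j) v) \<in> coords k \<and>
           (g \<circ> f) Q = proj_point (\<lambda>j. meval (h j) v))"
  proof (intro exI conjI allI ballI)
    show "zariski_closed n (zero_locus n {?r})"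
      unfolding zariski_closed_def forms_def using r by blast
    show "P \<notin> zero_locus n {?r}"
      using * P s t by blast
    show "is_form n (d * d') (msubst F (G j))" for j
      by (rule is_form_msubst[OF G F])
    fix Q v assume Q: "Q \<in> X - zero_locus n {?r}" and v: "v \<in> Q"
    have fQ: "f Q = proj_point (\<lambda>j. meval (F j) v)"
      using fF[of Q v] * Q v by blast
    have "(\<lambda>j. meval (F j) v) \<in> f Q"
      unfolding fQ by (rule self_in_proj_point)
    then have "(\<lambda>j. meval (G j) (\<lambda>j. meval (F j) v)) \<in> coords k \<and>
        g (f Q) = proj_point (\<lambda>j. meval (G j) (\<lambda>j. meval (F j) v))"
      using gG[of "f Q"] * Q morphism_Pi[OF f] by blast
    then show "(\<lambda>j. meval (msubst F (G j)) v) \<in> coords k"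
      "(g \<circ> f) Q = proj_point (\<lambda>j. meval (msubst F (G j)) v)"
      by simp_all
  qed
qed

text \<open>Linear forms without a common zero describe the map on the whole of \<open>X\<close>, so
  the excluded closed set is empty.\<close>

lemma linear_morphism:
  assumes G: "\<And>j. is_form n 1 (G j)"
    and L: "\<And>v. v \<in> coords n \<Longrightarrow> L v = (\<lambda>j. meval (G j) v)"
    and Lc: "\<And>v. v \<in> coords n \<Longrightarrow> L v \<in> coords m"
    and X: "X \<subseteq> proj_space n" and XY: "(`) L \<in> X \<rightarrow> Y"
  shows "morphism n X m Y ((`) L)"
  unfolding morphism_def
proof (intro conjI ballI exI)
  fix Q v assume Q: "Q \<in> X - {}" and v: "v \<in> Q"
  then have Qp: "Q \<in> proj_space n"
    using X by blast
  have vc: "v \<in> coords n"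
    using Qp v by (rule proj_space_member_coords)
  have "L (\<lambda>i. b * v i) = (\<lambda>j. b * L v j)" if "b \<noteq> 0" for b
    using that vc by (simp add: L scale_coords meval_scale[OF G])
  then have "L ` Q = proj_point (L v)"
    unfolding proj_point_eqI[OF Qp v] by (rule linear_image_proj_point)
  then show "L ` Q = proj_point (\<lambda>j. meval (G j) v)"
    using L vc by simp
  show "(\<lambda>j. meval (G j) v) \<in> coords m"
    using L Lc vc by metis
qed (use G XY zariski_closed_empty in auto)

section \<open>Isomorphisms and automorphisms\<close>

lemma isomorphism_compose:
  assumes "isomorphism n X m Y f" "isomorphism m Y k W g"
    and "X \<subseteq> proj_space n" "Y \<subseteq> proj_space m" "W \<subseteq> proj_space k"
  shows "isomorphism n X k W (g \<circ> f)"
proof -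
  obtain f' where f': "morphism m Y n X f'" "\<forall>P\<in>X. f' (f P) = P" "\<forall>Q\<in>Y. f (f' Q) = Q"
    using assms(1) by (auto simp: isomorphism_def)
  obtain g' where g': "morphism k W m Y g'" "\<forall>P\<in>Y. g' (g P) = P" "\<forall>Q\<in>W. g (g' Q) = Q"
    using assms(2) by (auto simp: isomorphism_def)
  have f: "morphism n X m Y f" and g: "morphism m Y k W g"
    using assms(1,2) by (simp_all add: isomorphism_def)
  have "morphism n X k W (g \<circ> f)"
    by (rule morphism_compose[OF f g assms(3,4)])
  moreover have "morphism k W n X (f' \<circ> g')"
    by (rule morphism_compose[OF g'(1) f'(1) assms(5,4)])
  moreover have "\<forall>P\<in>X. (f' \<circ> g') ((g \<circ> f) P) = P" "\<forall>Q\<in>W. (g \<circ> f) ((f' \<circ> g') Q) = Q"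
    using f' g' morphism_Pi[OF g'(1)] morphism_Pi[OF f] by simp_all
  ultimately show ?thesis
    unfolding isomorphism_def by blast
qed

lemma isomorphism_cong:
  assumes "isomorphism n X m Y f" "\<And>P. P \<in> X \<Longrightarrow> f P = f' P"
  shows "isomorphism n X m Y f'"
proof -
  obtain g where "morphism m Y n X g" "\<forall>P\<in>X. g (f P) = P" "\<forall>Q\<in>Y. f (g Q) = Q"
    using assms(1) by (auto simp: isomorphism_def)
  moreover have "morphism n X m Y f'"
    using assms morphism_cong unfolding isomorphism_def by metis
  ultimately show ?thesis
    unfolding isomorphism_def using assms(2) morphism_Pi[of m Y n X g]
    by (intro conjI exI[of _ g]) simp_all
qed

lemma isomorphism_id:
  assumes "X \<subseteq> proj_space n"
  shows "isomorphism n X n X id"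
proof -
  \<comment> \<open>Forms may involve only the variables up to \<open>n\<close>. Taking 0 beyond
    still gives the identity, as coordinate vectors vanish there.\<close>
  let ?G = "\<lambda>j. if j \<le> n then mvar j else 0"
  have "morphism n X n X ((`) id)"
    by (rule linear_morphism[of n ?G])
       (use assms in \<open>auto simp: coords_def fun_eq_iff simp del: One_nat_def intro: is_form_mvar\<close>)
  then have "morphism n X n X id"
    by (rule morphism_cong) simp
  then show ?thesis
    unfolding isomorphism_def by (intro conjI exI[of _ id]) simp_all
qed

lemma isomorphism_bij_betw: "isomorphism n X m Y f \<Longrightarrow> bij_betw f X Y"
proof -
  assume f: "isomorphism n X m Y f"
  then obtain g where "morphism m Y n X g" "\<forall>P\<in>X. g (f P) = P" "\<forall>Q\<in>Y. f (g Q) = Q"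
    by (auto simp: isomorphism_def)
  then show ?thesis
    using f by (intro bij_betw_byWitness[of X g f Y]) (auto simp: isomorphism_def dest: morphism_Pi)
qed

text \<open>Being an isomorphism depends only on the values on \<open>X\<close>, whereas the
  elements of \<open>Bij X\<close> are extensional, so each isomorphism is represented by its
  restriction.\<close>

lemma restrict_isomorphism_in_Aut:
  assumes "isomorphism n X n X f"
  shows "restrict f X \<in> carrier (Aut n X)"
proof -
  have iso: "isomorphism n X n X (restrict f X)"
    by (rule isomorphism_cong[OF assms]) simp
  then show ?thesis
    using isomorphism_bij_betw[OF iso] by (simp add: Aut_def Bij_def)
qed


section \<open>Complex conjugation\<close>

definition conj_point :: "complex point \<Rightarrow> complex point" where
  "conj_point P = (\<lambda>v. cnj \<circ> v) ` P"

lemma conj_point_conj_point [simp]: "conj_point (conj_point P) = P"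
  by (simp add: conj_point_def image_image comp_def)

lemma cnj_comp_in_coords [simp]: "cnj \<circ> v \<in> coords n \<longleftrightarrow> v \<in> coords n"
  by (simp add: coords_def)

lemma conj_point_proj_point: "conj_point (proj_point v) = proj_point (cnj \<circ> v)"
proof -
  have "(\<lambda>i. b * cnj (v i)) \<in> conj_point (proj_point v)" if "b \<noteq> 0" for b
    using that by (auto simp: conj_point_def proj_point_def comp_def
        intro!: image_eqI[of _ _ "\<lambda>i. cnj b * v i"] exI[of _ "cnj b"])
  moreover have "cnj \<circ> (\<lambda>i. b * v i) \<in> proj_point (cnj \<circ> v)" if "b \<noteq> 0" for b
    using that by (auto simp: proj_point_def comp_def intro!: exI[of _ "cnj b"])
  ultimately show ?thesis
    by (auto simp: conj_point_def proj_point_def)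
qed

lemma conj_point_in_proj_space_iff [simp]: "conj_point P \<in> proj_space n \<longleftrightarrow> P \<in> proj_space n"
proof -
  have "conj_point P \<in> proj_space n" if "P \<in> proj_space n" for P
    using that by (auto simp: proj_space_def conj_point_proj_point)
  from this[of P] this[of "conj_point P"] show ?thesis
    by auto
qed

lemma cnj_comp_cnj_comp: "cnj \<circ> (cnj \<circ> v) = v"
  by (simp add: fun_eq_iff)

lemma in_conj_image_iff: "P \<in> conj_point ` X \<longleftrightarrow> conj_point P \<in> X"
  by (metis conj_point_conj_point image_iff)

section \<open>Conjugating polynomials, closed sets and morphisms\<close>

lemma lookup_map_cnj: "Poly_Mapping.lookup (Poly_Mapping.map cnj p) e = cnj (Poly_Mapping.lookup p e)"
  by (simp add: Poly_Mapping.map.rep_eq when_def)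

lemma keys_map_cnj [simp]: "Poly_Mapping.keys (Poly_Mapping.map cnj p) = Poly_Mapping.keys p"
  by (auto simp: in_keys_iff lookup_map_cnj)

lemma is_form_map_cnj [simp]: "is_form n d (Poly_Mapping.map cnj p) \<longleftrightarrow> is_form n d p"
  by (simp add: is_form_def)

text \<open>Conjugation is a ring homomorphism and an involution, so it can be moved from the
  coefficients to the arguments and the value.\<close>

lemma meval_map_cnj: "meval (Poly_Mapping.map cnj p) v = cnj (meval p (cnj \<circ> v))"
  by (simp add: meval_def lookup_map_cnj)

lemma zero_locus_map_cnj: "zero_locus n (Poly_Mapping.map cnj ` S) = conj_point ` zero_locus n S"
proof -
  have "P \<in> zero_locus n (Poly_Mapping.map cnj ` S) \<longleftrightarrow> conj_point P \<in> zero_locus n S" for P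
    by (simp add: zero_locus_def meval_map_cnj) (simp add: conj_point_def)
  then show ?thesis
    using in_conj_image_iff by blast
qed

lemma zariski_closed_conj:
  assumes "zariski_closed n Z"
  shows "zariski_closed n (conj_point ` Z)"
proof -
  obtain S where "S \<subseteq> forms n" "Z = zero_locus n S"
    using assms by (auto simp: zariski_closed_def)
  then show ?thesis
    unfolding zariski_closed_def
    by (intro exI[of _ "Poly_Mapping.map cnj ` S"]) (auto simp: zero_locus_map_cnj forms_def)
qed

lemma conjugate_variety_cnj:
  "zariski_closed n X \<Longrightarrow> conjugate_variety n cnj X = conj_point ` X"
  by (simp add: conjugate_variety_def zero_locus_map_cnj zero_locus_equations)

text \<open>Conjugating both before and after \<open>f\<close> leaves a map that is again given by
  forms: only the coefficients of the local forms are conjugated.\<close>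

lemma morphism_conj:
  assumes "morphism n X m Y f"
  shows "morphism n (conj_point ` X) m (conj_point ` Y) (conj_point \<circ> f \<circ> conj_point)"
  unfolding morphism_def
proof (intro conjI ballI)
  show "conj_point \<circ> f \<circ> conj_point \<in> conj_point ` X \<rightarrow> conj_point ` Y"
    using assms by (auto simp: morphism_def)
  fix P assume "P \<in> conj_point ` X"
  then have P: "conj_point P \<in> X"
    by (simp add: in_conj_image_iff)
  obtain Z d g where *: "zariski_closed n Z" "conj_point P \<notin> Z" "\<forall>j. is_form n d (g j)"
    and f: "\<And>Q v. Q \<in> X - Z \<Longrightarrow> v \<in> Q \<Longrightarrow>
      (\<lambda>j. meval (g j) v) \<in> coords m \<and> f Q = proj_point (\<lambda>j. meval (g j) v)"
    using assms P unfolding morphism_def by meson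
  show "\<exists>Z d g. zariski_closed n Z \<and> P \<notin> Z \<and> (\<forall>j. is_form n d (g j)) \<and>
        (\<forall>Q\<in>conj_point ` X - Z. \<forall>v\<in>Q. (\<lambda>j. meval (g j) v) \<in> coords m \<and>
           (conj_point \<circ> f \<circ> conj_point) Q = proj_point (\<lambda>j. meval (g j) v))"
  proof (intro exI conjI allI ballI)
    show "zariski_closed n (conj_point ` Z)" "P \<notin> conj_point ` Z"
      using * by (auto simp: zariski_closed_conj)
    show "is_form n d (Poly_Mapping.map cnj (g j))" for j
      using * by simp
    fix Q v assume Q: "Q \<in> conj_point ` X - conj_point ` Z" and v: "v \<in> Q"
    have "conj_point Q \<in> X - Z" "cnj \<circ> v \<in> conj_point Q"
      using Q v by (auto simp: in_conj_image_iff conj_point_def[of Q])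
    note f = f[OF this]
    have eq: "(\<lambda>j. meval (Poly_Mapping.map cnj (g j)) v) = cnj \<circ> (\<lambda>j. meval (g j) (cnj \<circ> v))"
      by (simp add: meval_map_cnj fun_eq_iff)
    show "(\<lambda>j. meval (Poly_Mapping.map cnj (g j)) v) \<in> coords m"
      unfolding eq using f by simp
    show "(conj_point \<circ> f \<circ> conj_point) Q = proj_point (\<lambda>j. meval (Poly_Mapping.map cnj (g j)) v)"
      unfolding eq using f by (simp add: conj_point_proj_point)
  qed
qed

text \<open>A real generator that vanishes at \<open>v\<close> also vanishes at the conjugate of
  \<open>v\<close>. Since the generators span all equations of \<open>Y\<close>, and these cut out
  \<open>Y\<close>, conjugation preserves \<open>Y\<close>.\<close>

lemma defined_over_Reals_conj:
  assumes Y: "zariski_closed m Y" and "defined_over \<real> m Y"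
  shows "conj_point ` Y = Y"
proof -
  obtain S where S: "S \<subseteq> equations m Y" "\<And>p e. p \<in> S \<Longrightarrow> Poly_Mapping.lookup p e \<in> \<real>"
    "equations m Y \<subseteq> module.span (*) S"
    using assms(2) by (auto simp: defined_over_def)
  interpret module "(*) :: complex mpoly \<Rightarrow> complex mpoly \<Rightarrow> complex mpoly"
    by standard (auto simp: algebra_simps)
  have conjY: "conj_point P \<in> Y" if P: "P \<in> Y" for P
  proof -
    have "meval p (cnj \<circ> v) = 0" if p: "p \<in> equations m Y" and v: "v \<in> P" for p v
    proof -
      have gen: "meval s (cnj \<circ> v) = 0" if s: "s \<in> S" for s
      proof -
        have real: "Poly_Mapping.map cnj s = s"
          by (rule poly_mapping_eqI) (use S(2)[OF s] in \<open>auto simp: lookup_map_cnj Reals_cnj_iff\<close>)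
        have "meval s v = 0"
          using S(1) s P v by (auto simp: equations_def)
        then show ?thesis
          using meval_map_cnj[of s "cnj \<circ> v"] unfolding real cnj_comp_cnj_comp
          by (simp only: complex_cnj_zero)
      qed
      obtain t r where t: "t \<subseteq> S" "p = (\<Sum>a\<in>t. r a * a)"
        using S(3) p by (auto simp: span_explicit)
      then show ?thesis
        using gen by (auto intro!: sum.neutral)
    qed
    then have "\<forall>p\<in>equations m Y. \<forall>v\<in>conj_point P. meval p v = 0"
      by (simp add: conj_point_def)
    moreover have "P \<in> proj_space m"
      using P zariski_closed_subset[OF Y] by blast
    ultimately have "conj_point P \<in> zero_locus m (equations m Y)"
      by (simp add: zero_locus_def)
    then show ?thesis
      by (simp add: zero_locus_equations[OF Y])
  qed
  \<comment> \<open>The reverse inclusion follows because \<open>conj_point\<close> is an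
    involution.\<close>
  then show ?thesis
    using in_conj_image_iff by fastforce
qed


section \<open>The quartics\<close>

lemma meval_quartic:
  "meval (quartic a1 a2 a3) v = v 1 ^ 4 + v 1 ^ 2 * (v 0 - a1 * v 2) * (v 0 + 1 / a1 * v 2)
     + (v 0 - a2 * v 2) * (v 0 + 1 / cnj a2 * v 2) * (v 0 - a3 * v 2) * (v 0 + 1 / cnj a3 * v 2)"
  by (simp add: quartic_def Let_def)

lemma is_form_quartic: "is_form 2 4 (quartic a1 a2 a3)"
proof -
  have lin: "is_form 2 1 (mvar 0 + mconst c * mvar 2)" for c :: complex
    using is_form_mult[OF is_form_mconst is_form_mvar, of 2 2 c] is_form_mvar[of 0 2]
    by (auto intro: is_form_add)
  have lin': "is_form 2 1 (mvar 0 - mconst c * mvar 2)" for c :: complex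
  proof -
    have "mconst (- c) = - mconst c"
      by (simp add: mconst_def single_uminus)
    then show ?thesis
      using lin[of "- c"] by simp
  qed
  have y: "is_form 2 k (mvar 1 ^ k)" for k
    using is_form_power[OF is_form_mvar, of 1 2 k] by simp
  have "is_form 2 4 (mvar 1 ^ 2 * (mvar 0 - mconst a1 * mvar 2) * (mvar 0 + mconst (1 / a1) * mvar 2))"
    using is_form_mult[OF is_form_mult[OF y[of 2] lin'[of a1]] lin[of "1 / a1"]] by simp
  moreover have "is_form 2 4 ((mvar 0 - mconst a2 * mvar 2) * (mvar 0 + mconst (1 / cnj a2) * mvar 2)
       * (mvar 0 - mconst a3 * mvar 2) * (mvar 0 + mconst (1 / cnj a3) * mvar 2))"
    using is_form_mult[OF is_form_mult[OF is_form_mult[OF lin'[of a2] lin[of "1 / cnj a2"]]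
      lin'[of a3]] lin[of "1 / cnj a3"]] by (simp add: numeral_eq_Suc)
  ultimately show ?thesis
    unfolding quartic_def Let_def by (rule is_form_add[OF is_form_add[OF y[of 4]]])
qed

lemma zariski_closed_quartic_curve: "zariski_closed 2 (quartic_curve a1 a2 a3)"
  unfolding zariski_closed_def forms_def quartic_curve_def
  by (intro exI[of _ "{quartic a1 a2 a3}"]) (use is_form_quartic in auto)

lemma in_quartic_curve_iff:
  "P \<in> quartic_curve a1 a2 a3 \<longleftrightarrow>
     P \<in> proj_space 2 \<and> (\<forall>v\<in>P. meval (quartic a1 a2 a3) v = 0)"
  by (simp add: quartic_curve_def zero_locus_def)

text \<open>\<open>twist \<i>\<close> and \<open>flip\<close> act on coordinate vectors; their images of points are the
  maps \<open>\<mu>\<close> and \<open>\<iota>\<close>.\<close>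

definition twist :: "complex \<Rightarrow> (nat \<Rightarrow> complex) \<Rightarrow> nat \<Rightarrow> complex" where
  "twist t v = (\<lambda>i. if i = 0 then - v 2 else if i = 1 then t * v 1 else if i = 2 then v 0 else 0)"

definition flip :: "(nat \<Rightarrow> complex) \<Rightarrow> nat \<Rightarrow> complex" where
  "flip v = v(1 := - v 1)"

text \<open>The square of \<open>y\<close> and the quadratic factor with the real \<open>a1\<close>
  both change sign. The pairs of linear factors for \<open>a2\<close> and \<open>a3\<close> acquire
  the scalars \<open>-(a2 / cnj a2)\<close> and \<open>-(a3 / cnj a3)\<close>. Both
  \<open>t = \<i>\<close> and \<open>t = -\<i>\<close> will be used.\<close>

lemma meval_quartic_twist:
  assumes a1: "a1 \<in> \<real> - {0}" and a2: "a2 \<noteq> 0" and a3: "a3 \<noteq> 0" and real: "a2 * a3 \<in> \<real>"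
    and t: "t\<^sup>2 = -1"
  shows "meval (quartic a1 a2 a3) (cnj \<circ> twist t v) = cnj (meval (quartic a1 a2 a3) v)"
proof -
  define x y z where "x = cnj (v 0)" and "y = cnj (v 1)" and "z = cnj (v 2)"
  have [simp]: "cnj a1 = a1" "a1 \<noteq> 0"
    using a1 by (auto simp: Reals_cnj_iff)
  \<comment> \<open>Reality of \<open>a2 * a3\<close> makes the product of the two scalars from the
    linear factors equal to 1.\<close>
  have "a2 * a3 = cnj a2 * cnj a3"
    using real by (simp add: Reals_cnj_iff)
  then have r: "a2 * a3 / (cnj a2 * cnj a3) = 1"
    using a2 a3 by simp
  have t2: "(cnj t)\<^sup>2 = -1"
    using t by (metis complex_cnj_minus complex_cnj_one complex_cnj_power)
  then have "(cnj t * y)\<^sup>2 = - y\<^sup>2"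
    by (simp add: power_mult_distrib)
  moreover from this have "(cnj t * y) ^ 4 = y ^ 4"
    using power_mult[of "cnj t * y" 2 2] power_mult[of y 2 2] by simp
  moreover have "(- z - a1 * x) * (- z + 1 / a1 * x) = - ((x - a1 * z) * (x + 1 / a1 * z))"
    by (simp add: field_simps)
  moreover have "(- z - a * x) * (- z + 1 / cnj a * x) = - (a / cnj a) * ((x - cnj a * z) * (x + 1 / a * z))"
    if "a \<noteq> 0" for a
    using that by (simp add: field_simps)
  from this[OF a2] this[OF a3]
  have "(- z - a2 * x) * (- z + 1 / cnj a2 * x) * ((- z - a3 * x) * (- z + 1 / cnj a3 * x)) =
    (a2 * a3 / (cnj a2 * cnj a3)) *
    ((x - cnj a2 * z) * (x + 1 / a2 * z) * ((x - cnj a3 * z) * (x + 1 / a3 * z)))"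
    by simp
  ultimately show ?thesis
    unfolding r by (simp add: meval_quartic twist_def x_def y_def z_def mult.assoc)
qed

lemma meval_quartic_flip: "meval (quartic a1 a2 a3) (flip v) = meval (quartic a1 a2 a3) v"
  by (simp add: meval_quartic flip_def)

section \<open>The induced maps on points of the plane\<close>

lemma ex_le_2_iff: "(\<exists>i\<le>2::nat. Q i) \<longleftrightarrow> Q 0 \<or> Q 1 \<or> Q 2"
  by (metis le_0_eq le_Suc_eq numeral_2_eq_2 One_nat_def)

lemma flip_in_coords: "v \<in> coords 2 \<Longrightarrow> flip v \<in> coords 2"
  by (simp add: coords_def ex_le_2_iff flip_def)

lemma twist_in_coords: "v \<in> coords 2 \<Longrightarrow> t \<noteq> 0 \<Longrightarrow> twist t v \<in> coords 2"
  by (auto simp: coords_def ex_le_2_iff twist_def)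

lemma linear_image_in_proj_space:
  assumes "P \<in> proj_space n" "\<And>v. v \<in> coords n \<Longrightarrow> L v \<in> coords m"
    and "\<And>c v. L (\<lambda>i. c * v i) = (\<lambda>i. c * L v i)"
  shows "L ` P \<in> proj_space m"
proof -
  obtain v where v: "v \<in> coords n" "P = proj_point v"
    using assms by (elim proj_spaceE)
  have "L ` P = proj_point (L v)"
    unfolding v by (rule linear_image_proj_point[OF assms(3)])
  then show ?thesis
    using assms v by (simp add: proj_space_def)
qed

lemma flip_scale: "flip (\<lambda>i. c * v i) = (\<lambda>i. c * flip v i)"
  by (auto simp: flip_def)

lemma twist_scale: "twist t (\<lambda>i. c * v i) = (\<lambda>i. c * twist t v i)"
  by (auto simp: twist_def)

lemma flip_in_proj_space: "P \<in> proj_space 2 \<Longrightarrow> flip ` P \<in> proj_space 2"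
  by (rule linear_image_in_proj_space[OF _ flip_in_coords flip_scale])

lemma twist_in_proj_space: "t \<noteq> 0 \<Longrightarrow> P \<in> proj_space 2 \<Longrightarrow> twist t ` P \<in> proj_space 2"
  by (rule linear_image_in_proj_space[OF _ twist_in_coords twist_scale])

text \<open>Maps on coordinate vectors that differ by a nonzero scalar agree on points. In the
  identities below the scalar is -1.\<close>

lemma image_point_eqI:
  fixes P :: "'a::field point"
  assumes "P \<in> proj_space n" "c \<noteq> 0"
    and "\<And>v. v \<in> coords n \<Longrightarrow> L v = (\<lambda>i. c * M v i)" "\<And>c v. M (\<lambda>i. c * v i) = (\<lambda>i. c * M v i)"
  shows "L ` P = M ` P"
proof -
  have "L v = M (\<lambda>i. c * v i)" if "v \<in> P" for v
    unfolding assms(4) by (rule assms(3)[OF proj_space_member_coords[OF assms(1) that]])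
  then have "L ` P = M ` (\<lambda>v i. c * v i) ` P"
    unfolding image_image by (intro image_cong refl)
  then show ?thesis
    by (simp add: scale_image_point[OF assms(1,2)])
qed

lemma twist_twist_ii:
  assumes "P \<in> proj_space 2"
  shows "twist \<i> ` twist \<i> ` P = P"
proof -
  have "(\<lambda>v. twist \<i> (twist \<i> v)) ` P = id ` P"
    by (rule image_point_eqI[OF assms, of "-1"])
       (auto simp: twist_def coords_def fun_eq_iff not_less_iff_gr_or_eq less_2_cases_iff)
  then show ?thesis
    by (simp add: image_image)
qed

text \<open>On vectors the composite sends \<open>(x, y, z)\<close> to \<open>(-x, y, -z)\<close>,
  which is -1 times \<open>(x, -y, z)\<close>. This is the obstruction to a real model for the
  choice of \<mu>.\<close>

lemma conj_twist_conj_twist: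
  assumes "P \<in> proj_space 2"
  shows "conj_point (twist \<i> ` conj_point (twist \<i> ` P)) = flip ` P"
proof -
  have "(\<lambda>v. cnj \<circ> twist \<i> (cnj \<circ> twist \<i> v)) ` P = flip ` P"
    by (rule image_point_eqI[OF assms, of "-1"])
       (auto simp: twist_def flip_def coords_def fun_eq_iff not_less_iff_gr_or_eq less_2_cases_iff)
  then show ?thesis
    by (simp add: image_image conj_point_def)
qed

text \<open>Replacing \<mu> by its composite with \<iota> inserts \<iota> twice. The two sign
  changes of \<open>y\<close> cancel, so the obstruction is the same.\<close>

lemma conj_twist_flip_conj_twist_flip:
  assumes "P \<in> proj_space 2"
  shows "conj_point (twist \<i> ` flip ` conj_point (twist \<i> ` flip ` P)) = flip ` P"
proof -
  have "(\<lambda>v. cnj \<circ> twist \<i> (flip (cnj \<circ> twist \<i> (flip v)))) ` P = flip ` P"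
    by (rule image_point_eqI[OF assms, of "-1"])
       (auto simp: twist_def flip_def coords_def fun_eq_iff not_less_iff_gr_or_eq less_2_cases_iff)
  then show ?thesis
    by (simp add: image_image conj_point_def)
qed

lemma flip_flip_point: "flip ` flip ` P = P"
  by (simp add: image_image flip_def)

lemma is_form_scaled_mvar: "i \<le> n \<Longrightarrow> is_form n 1 (mconst c * mvar i)"
  using is_form_mult[OF is_form_mconst is_form_mvar] by fastforce

section \<open>The isomorphisms of the quartics\<close>

lemma flip_isomorphism: "isomorphism 2 (quartic_curve a1 a2 a3) 2 (quartic_curve a1 a2 a3) ((`) flip)"
proof -
  let ?X = "quartic_curve a1 a2 a3"
  let ?G = "\<lambda>j. if j \<le> 2 then mconst (if j = 1 then -1 else 1) * mvar j else 0"
  have "morphism 2 ?X 2 ?X ((`) flip)"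
  proof (rule linear_morphism[of 2 ?G])
    show "is_form 2 1 (?G j)" for j
      using is_form_scaled_mvar by auto
    show "flip v = (\<lambda>j. meval (?G j) v)" if "v \<in> coords 2" for v
      using that by (auto simp: flip_def coords_def fun_eq_iff)
    show "(`) flip \<in> ?X \<rightarrow> ?X"
      by (auto simp: in_quartic_curve_iff flip_in_proj_space meval_quartic_flip)
  qed (auto simp: flip_in_coords in_quartic_curve_iff)
  then show ?thesis
    unfolding isomorphism_def by (intro conjI exI[of _ "(`) flip"] ballI flip_flip_point)
qed

lemma twist_morphism:
  assumes "t \<noteq> 0" "X \<subseteq> proj_space 2" "(`) (twist t) \<in> X \<rightarrow> Y"
  shows "morphism 2 X 2 Y ((`) (twist t))"
proof (rule linear_morphism)
  let ?G = "\<lambda>j::nat. if j = 0 then mconst (-1) * mvar 2 else if j = 1 then mconst t * mvar 1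
    else if j = 2 then mconst 1 * mvar 0 else 0"
  show "is_form 2 1 (?G j)" for j
    using is_form_scaled_mvar by auto
  show "twist t v = (\<lambda>j. meval (?G j) v)" for v
    by (auto simp: twist_def fun_eq_iff)
qed (use assms twist_in_coords in auto)

text \<open>On points \<open>twist \<i>\<close> is its own inverse, so it suffices that it maps
  \<open>X\<close> into its conjugate and the conjugate into \<open>X\<close>.\<close>

lemma twist_isomorphism:
  assumes "a1 \<in> \<real> - {0}" "a2 \<noteq> 0" "a3 \<noteq> 0" "a2 * a3 \<in> \<real>"
  defines "X \<equiv> quartic_curve a1 a2 a3"
  shows "isomorphism 2 X 2 (conj_point ` X) ((`) (twist \<i>))"
    and "isomorphism 2 (conj_point ` X) 2 X ((`) (twist \<i>))"
proof -
  note q = meval_quartic_twist[OF assms(1-4)]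
  have Xp: "X \<subseteq> proj_space 2" "conj_point ` X \<subseteq> proj_space 2"
    by (auto simp: X_def in_quartic_curve_iff)
  have "twist \<i> ` P \<in> conj_point ` X" if P: "P \<in> X" for P
  proof -
    have "meval (quartic a1 a2 a3) w = 0" if "w \<in> conj_point (twist \<i> ` P)" for w
      using P that by (auto simp: X_def in_quartic_curve_iff q conj_point_def)
    then show ?thesis
      using P by (simp add: X_def in_conj_image_iff in_quartic_curve_iff twist_in_proj_space)
  qed
  then have "morphism 2 X 2 (conj_point ` X) ((`) (twist \<i>))"
    by (intro twist_morphism) (use Xp in auto)
  moreover have "twist \<i> ` conj_point P \<in> X" if P: "P \<in> X" for P
  proof -
    \<comment> \<open>Moving the conjugation outside turns \<open>\<i>\<close> into
      \<open>-\<i>\<close>, whose square is also -1, so the invariance of the quartic applies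
      again.\<close>
    have "twist \<i> (cnj \<circ> v) = cnj \<circ> twist (- \<i>) v" for v
      by (auto simp: twist_def fun_eq_iff)
    then have "meval (quartic a1 a2 a3) w = 0" if "w \<in> twist \<i> ` conj_point P" for w
      using P that by (auto simp: X_def in_quartic_curve_iff q conj_point_def)
    then show ?thesis
      using P by (simp add: X_def in_quartic_curve_iff twist_in_proj_space)
  qed
  then have "morphism 2 (conj_point ` X) 2 X ((`) (twist \<i>))"
    by (intro twist_morphism) (use Xp in auto)
  moreover have "\<forall>P\<in>X. twist \<i> ` twist \<i> ` P = P" "\<forall>P\<in>conj_point ` X. twist \<i> ` twist \<i> ` P = P"
    using twist_twist_ii Xp by blast+
  ultimately show "isomorphism 2 X 2 (conj_point ` X) ((`) (twist \<i>))"
    "isomorphism 2 (conj_point ` X) 2 X ((`) (twist \<i>))"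
    unfolding isomorphism_def by blast+
qed

text \<open>A point \<open>(x : y : 1)\<close> with \<open>y\<close> nonzero is moved by \<iota>:
  the last coordinate forces the scalar 1, which contradicts the sign change of
  \<open>y\<close>.\<close>

lemma flip_nontrivial:
  obtains P where "P \<in> quartic_curve a1 a2 a3" "flip ` P \<noteq> P"
proof -
  let ?R = "[:- a2, 1:] * [:1 / cnj a2, 1:] * [:- a3, 1:] * [:1 / cnj a3, 1:]"
  have poly_R: "poly ?R x = (x - a2) * (x + 1 / cnj a2) * (x - a3) * (x + 1 / cnj a3)" for x
    by (simp add: add.commute[of x] del: mult_pCons_left mult_pCons_right)
  have "?R \<noteq> 0"
    by simp
  \<comment> \<open>Avoiding the roots of \<open>?R\<close> makes the constant term of the equation
    for \<open>y\<close> nonzero, so each of its solutions is nonzero.\<close>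
  then obtain x where x: "poly ?R x \<noteq> 0"
    using poly_all_0_iff_0 by blast
  let ?q = "(x - a1) * (x + 1 / a1)" and ?r = "poly ?R x"
  have "degree [:?r, 0, ?q, 0, 1:] \<noteq> 0"
    by simp
  then obtain y where "poly [:?r, 0, ?q, 0, 1:] y = 0"
    using alg_closed_imp_poly_has_root by blast
  then have y: "y ^ 4 + y\<^sup>2 * ?q + ?r = 0"
    by (simp add: algebra_simps power2_eq_square power4_eq_xxxx)
  then have "y \<noteq> 0"
    using x by auto
  define v :: "nat \<Rightarrow> complex" where "v = (\<lambda>i. if i = 0 then x else if i = 1 then y else if i = 2 then 1 else 0)"
  have v: "v \<in> coords 2"
    by (auto simp: v_def coords_def)
  have "meval (quartic a1 a2 a3) v = 0"
    using y unfolding poly_R by (simp add: meval_quartic v_def mult.assoc)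
  then have "meval (quartic a1 a2 a3) (\<lambda>i. c * v i) = 0" for c
    by (simp add: meval_scale[OF is_form_quartic])
  then have "proj_point v \<in> quartic_curve a1 a2 a3"
    using v by (auto simp: in_quartic_curve_iff proj_space_def proj_point_def)
  moreover have "flip ` proj_point v \<noteq> proj_point v"
  proof
    assume "flip ` proj_point v = proj_point v"
    then have "flip v \<in> proj_point v"
      using self_in_proj_point by blast
    then obtain c where c: "flip v = (\<lambda>i. c * v i)"
      by (auto simp: proj_point_def)
    have "c = 1" "- y = c * y"
      using fun_cong[OF c, of 2] fun_cong[OF c, of 1] by (simp_all add: flip_def v_def)
    then show False
      using \<open>y \<noteq> 0\<close> by simp
  qed
  ultimately show ?thesis
    by (rule that)
qed

section \<open>Field of moduli and fields of definition of the quartics\<close>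

theorem proposition4p3:
  fixes a1 a2 a3 :: complex
  assumes "a1 \<in> \<real> - {0}" and "a2 \<noteq> 0" and "a3 \<noteq> 0" and "a2 * a3 \<in> \<real>"
    and "smooth_hypersurface 2 (quartic a1 a2 a3)"
    and "Aut 2 (quartic_curve a1 a2 a3) \<cong> integer_mod_group 2"
  shows "field_of_moduli \<real> 2 (quartic_curve a1 a2 a3) = \<real> \<and>
    \<not> field_of_definition \<real> 2 (quartic_curve a1 a2 a3)"
proof
  let ?X = "quartic_curve a1 a2 a3"
  note twist = twist_isomorphism[OF assms(1-4)]
  note closed = zariski_closed_quartic_curve[of a1 a2 a3]
  have Xp: "?X \<subseteq> proj_space 2"
    by (rule zariski_closed_subset[OF closed])
  have cXp: "conj_point ` ?X \<subseteq> proj_space 2"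
    by (rule zariski_closed_subset[OF zariski_closed_conj[OF closed]])
  have "cnj \<in> field_auts \<real>"
    by (auto simp: field_auts_def Reals_cnj_iff intro!: bij_betw_byWitness[of _ cnj])
  moreover have "isomorphic 2 ?X 2 (conjugate_variety 2 cnj ?X)"
    unfolding conjugate_variety_cnj[OF closed] isomorphic_def using twist(1) by blast
  ultimately show "field_of_moduli \<real> 2 ?X = \<real>"
    by (auto simp: field_of_moduli_def field_auts_def Reals_cnj_iff)
  obtain P0 where P0: "P0 \<in> ?X" "flip ` P0 \<noteq> P0"
    by (rule flip_nontrivial)
  \<comment> \<open>The automorphism group has exactly two elements, and the identity and \<iota>
    are two different ones because \<open>P0\<close> is moved.\<close>
  have aut: "(\<forall>P\<in>?X. f P = P) \<or> (\<forall>P\<in>?X. f P = flip ` P)" if f: "isomorphism 2 ?X 2 ?X f" for f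
  proof -
    let ?A = "carrier (Aut 2 ?X)"
    obtain h where "bij_betw h ?A (carrier (integer_mod_group 2))"
      using assms(6) by (auto simp: is_iso_def iso_def)
    then have "card ?A = 2"
      using bij_betw_same_card[of h] by (simp add: carrier_integer_mod_group)
    have sub: "{restrict id ?X, restrict ((`) flip) ?X} \<subseteq> ?A"
      using restrict_isomorphism_in_Aut isomorphism_id[OF Xp] flip_isomorphism by blast
    moreover have "restrict id ?X P0 \<noteq> restrict ((`) flip) ?X P0"
      using P0 by simp
    then have "card {restrict id ?X, restrict ((`) flip) ?X} = 2"
      by (metis card_2_iff)
    ultimately have "?A = {restrict id ?X, restrict ((`) flip) ?X}"
      using \<open>card ?A = 2\<close> by (metis card_subset_eq card.infinite zero_neq_numeral)
    then have "restrict f ?X = restrict id ?X \<or> restrict f ?X = restrict ((`) flip) ?X"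
      using restrict_isomorphism_in_Aut[OF f] by blast
    then show ?thesis
      by (metis id_apply restrict_apply')
  qed
  show "\<not> field_of_definition \<real> 2 ?X"
  proof
    assume "field_of_definition \<real> 2 ?X"
    then obtain m Y f where Y: "zariski_closed m Y" "defined_over \<real> m Y" and f: "isomorphism 2 ?X m Y f"
      by (auto simp: field_of_definition_def projective_curve_def irreducible_closed_def isomorphic_def)
    note cY = defined_over_Reals_conj[OF Y]
    have Yp: "Y \<subseteq> proj_space m"
      by (rule zariski_closed_subset[OF Y(1)])
    obtain g where fm: "morphism 2 ?X m Y f" and gm: "morphism m Y 2 ?X g"
      and gf: "\<And>P. P \<in> ?X \<Longrightarrow> g (f P) = P" and fg: "\<And>Q. Q \<in> Y \<Longrightarrow> f (g Q) = Q"
      using f by (auto simp: isomorphism_def)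
    have conjY: "conj_point Q \<in> Y" if "Q \<in> Y" for Q
      using cY that by blast
    \<comment> \<open>This is the inverse of the conjugate of \<open>f\<close>. It is defined on
      \<open>Y\<close> because \<open>Y\<close> equals its conjugate.\<close>
    define g' where "g' = conj_point \<circ> g \<circ> conj_point"
    have "isomorphism m Y 2 (conj_point ` ?X) g'"
      unfolding isomorphism_def
    proof (intro conjI exI ballI)
      show "morphism m Y 2 (conj_point ` ?X) g'"
        using morphism_conj[OF gm] by (simp add: cY g'_def)
      show "morphism 2 (conj_point ` ?X) m Y (conj_point \<circ> f \<circ> conj_point)"
        using morphism_conj[OF fm] by (simp add: cY)
    qed (auto simp: g'_def gf fg conjY)
    then have phi: "isomorphism 2 ?X 2 (conj_point ` ?X) (g' \<circ> f)"
      by (rule isomorphism_compose[OF f _ Xp Yp cXp])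
    \<comment> \<open>Following \<phi> by \<mu>, taken from the conjugate back to \<open>X\<close>,
      gives an automorphism of \<open>X\<close>, so only two cases remain.\<close>
    then have "isomorphism 2 ?X 2 ?X ((`) (twist \<i>) \<circ> (g' \<circ> f))"
      by (rule isomorphism_compose[OF _ twist(2) Xp cXp Xp])
    note dichotomy = aut[OF this]
    have phi_X: "g' (f P) \<in> conj_point ` ?X" if "P \<in> ?X" for P
      using phi that by (auto simp: isomorphism_def dest: morphism_Pi)
    \<comment> \<open>Since \<mu> is an involution on points, \<phi> can be recovered from that
      automorphism.\<close>
    have phi_eq: "g' (f P) = twist \<i> ` twist \<i> ` g' (f P)" if "P \<in> ?X" for P
      using twist_twist_ii phi_X[OF that] cXp by (metis subsetD)
    \<comment> \<open>The cocycle condition: the conjugate of \<phi> composed with \<phi> is the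
      identity, as the inner pair \<open>f\<close>, \<open>g\<close> and then the outer pair
      cancel.\<close>
    have inv: "conj_point (g' (f (conj_point (g' (f P))))) = P" if "P \<in> ?X" for P
      using that by (simp add: g'_def fg gf conjY morphism_Pi[OF fm])
    have P0': "conj_point (g' (f P0)) \<in> ?X"
      using phi_X[OF P0(1)] by (simp add: in_conj_image_iff)
    have P0p: "P0 \<in> proj_space 2"
      using P0 Xp by blast
    from dichotomy show False
    proof
      assume "\<forall>P\<in>?X. ((`) (twist \<i>) \<circ> (g' \<circ> f)) P = P"
      then have "g' (f P) = twist \<i> ` P" if "P \<in> ?X" for P
        using phi_eq that by (metis comp_apply)
      \<comment> \<open>Here \<phi> is \<mu>. Using this at \<open>P0\<close> and at the conjugate
        of its image turns the cocycle condition into invariance of \<open>P0\<close> under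
        \<iota>.\<close>
      then have "P0 = flip ` P0"
        using inv[OF P0(1)] P0 P0' conj_twist_conj_twist[OF P0p] by metis
      then show False
        using P0 by simp
    next
      assume "\<forall>P\<in>?X. ((`) (twist \<i>) \<circ> (g' \<circ> f)) P = flip ` P"
      then have "g' (f P) = twist \<i> ` flip ` P" if "P \<in> ?X" for P
        using phi_eq that by (metis comp_apply)
      then have "P0 = flip ` P0"
        using inv[OF P0(1)] P0 P0' conj_twist_flip_conj_twist_flip[OF P0p] by metis
      then show False
        using P0 by simp
    qed
  qed
qed

end
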